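(* Let $K$ be a field of characteristic different from $2$ with algebraic closure $\overline{K}$, let $f(z)=z^2-1$, and let $x_0\in K$ with $x_0\neq 0,-1$. Let $K_n:=K(f^{-n}(x_0))$, $K_\infty:=\bigcup_{n\ge0}K_n\subseteq\overline{K}$ and $G_\infty:=\mathrm{Gal}(K_\infty/K)$. Choose a sequence $\zeta_2,\zeta_4,\zeta_8,\ldots$ of primitive $2$-power roots of unity in $K_\infty$ ($\zeta_{2^m}$ a primitive $2^m$-th root of unity) with $(\zeta_{2^m})^2=\zeta_{2^{m-1}}$ for each $m\ge1$. Let $w\mapsto[w]$ be a labeling of the preimage tree of $x_0$ such that for every word $y$ over $\{a,b\}$ and every $i\ge0$, \[ \Bigg(\prod_{s_1,\ldots,s_i\in\{a,b\}}[y\,a\,s_1\,a\,s_2\cdots a\,s_i\,a]\Bigg)\Bigg(\prod_{s_1,\ldots,s_i\in\{a,b\}}[y\,b\,s_1\,a\,s_2\cdots a\,s_i\,a]\Bigg)^{-1}=\zeta_{2^{i+1}}. \] Then for every node (word) $y$, every $2$-power root of unity $\zeta\in K_\infty$, and every $\sigma\in G_\infty$ (regarded as an element of $\mathrm{Aut}(T_\infty)$ via the labeling), we have $\sigma(\zeta)=\zeta^{P(\sigma,y)}$.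
   Context: $f^n$ is the $n$-th iterate of $f$ and $f^{-n}(x_0)$ is the set of roots in $\overline{K}$ of $f^n(z)=x_0$ (it has $2^n$ elements). A labeling of the preimage tree is a bijection $w\mapsto[w]$ from finite words over $\{a,b\}$ onto $\coprod_{n\ge0}f^{-n}(x_0)$ with empty word $\mapsto x_0$, words of length $n$ mapping into $f^{-n}(x_0)$, and $\{[wa],[wb]\}=f^{-1}([w])$ for all $w$. The word $y\,a\,s_1\,a\,s_2\cdots a\,s_i\,a$ denotes concatenation. Via a labeling, $\sigma\in G_\infty$ acts on words by $\sigma([w])=[\sigma(w)]$, giving an element of $\mathrm{Aut}(T_\infty)$. Tree notation: $T_\infty$ is the infinite binary rooted tree whose nodes at level $m$ are the words of length $m$ over $\{a,b\}$ (root $x_0$ = empty word), with $w$ joined to $wa$ and $wb$; $\mathrm{Aut}(T_\infty)$ is its group of root-preserving tree automorphisms, so $\sigma$ maps $\{xa,xb\}$ onto $\{\sigma(x)a,\sigma(x)b\}$. Define $\mathrm{Par}(\sigma,x)=0$ if $\sigma(xa)=\sigma(x)a$ and $\sigma(xb)=\sigma(x)b$, and $\mathrm{Par}(\sigma,x)=1$ if $\sigma(xa)=\sigma(x)b$ and $\sigma(xb)=\sigma(x)a$. Define $Q(\sigma,x):=\sum_{i\ge0}2^i\sum_{s_1,\ldots,s_i\in\{a,b\}}\mathrm{Par}(\sigma,x\,a\,s_1\,a\,s_2\cdots a\,s_i)\in\mathbb{Z}_2$ (the $i=0$ term is $\mathrm{Par}(\sigma,x)$), and $P(\sigma,x):=(-1)^{\mathrm{Par}(\sigma,x)}+2\sum_{t\in\{a,b\}}Q(\sigma,xbt)-2\sum_{t\in\{a,b\}}Q(\sigma,xat)\in\mathbb{Z}_2^\times$.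 For $u\in\mathbb{Z}_2$ and $\zeta$ a root of unity of order $2^k$, $\zeta^u$ means $\zeta^{u'}$ for any integer $u'\equiv u\pmod{2^k}$. *)

theory Defs
  imports "HOL-Algebra.Algebraic_Closure_Type" "HOL-Algebra.Generated_Fields"
begin

section \<open>The ring of 2-adic integers\<close>

text \<open>
  The inverse limit of the rings of integers modulo \<open>2 ^ n\<close>: an element is given by its
  canonical residues, the \<open>n\<close>-th one lying in \<open>{0..<2 ^ n}\<close>.
\<close>

typedef two_adic = "{r :: nat \<Rightarrow> int. \<forall>n. r (Suc n) mod 2 ^ n = r n}"
  morphisms res Abs_two_adic
  by (rule exI[of _ "\<lambda>_. 0"]) simp

setup_lifting type_definition_two_adic

lemma mod_two_power_Suc: "(a :: int) mod 2 ^ Suc n mod 2 ^ n = a mod 2 ^ n"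
  by (simp add: mod_mod_cancel)

lemma res_Suc: "res x (Suc n) mod 2 ^ n = res x n"
  using res[of x] by simp

lemma res_mod_le: "n \<le> m \<Longrightarrow> res x m mod 2 ^ n = res x n"
proof (induction m)
  case 0
  then show ?case using res_Suc[of x 0] by simp
next
  case (Suc m)
  show ?case
  proof (cases "n = Suc m")
    case True
    have "res x n = res x (Suc n) mod 2 ^ n" by (simp only: res_Suc)
    then show ?thesis using True by (metis mod_mod_trivial)
  next
    case False
    then have "n \<le> m" using Suc.prems by simp
    then have "res x (Suc m) mod 2 ^ n = res x (Suc m) mod 2 ^ m mod 2 ^ n"
      by (simp add: mod_mod_cancel le_imp_power_dvd)
    then show ?thesis using Suc.IH \<open>n \<le> m\<close> by (simp add: res_Suc)
  qed
qed

lemma res_mod [simp]: "res x n mod 2 ^ n = res x n"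
  by (rule res_mod_le) simp

lemma res_0 [simp]: "res x 0 = 0"
  using res_mod[of x 0] by simp

lemma two_adic_eqI: "(\<And>n. res x n = res y n) \<Longrightarrow> x = y"
  by (auto simp: res_inject[symmetric])

instantiation two_adic :: comm_ring_1
begin

lift_definition zero_two_adic :: two_adic is "\<lambda>_. 0" by simp

lift_definition one_two_adic :: two_adic is "\<lambda>n. 1 mod 2 ^ n"
  unfolding mod_two_power_Suc by (rule refl)

lift_definition plus_two_adic :: "two_adic \<Rightarrow> two_adic \<Rightarrow> two_adic"
  is "\<lambda>x y n. (x n + y n) mod 2 ^ n"
  unfolding mod_two_power_Suc by (metis mod_add_eq)

lift_definition minus_two_adic :: "two_adic \<Rightarrow> two_adic \<Rightarrow> two_adic"
  is "\<lambda>x y n. (x n - y n) mod 2 ^ n"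
  unfolding mod_two_power_Suc by (metis mod_diff_eq)

lift_definition uminus_two_adic :: "two_adic \<Rightarrow> two_adic"
  is "\<lambda>x n. (- x n) mod 2 ^ n"
  unfolding mod_two_power_Suc by (metis mod_minus_eq)

lift_definition times_two_adic :: "two_adic \<Rightarrow> two_adic \<Rightarrow> two_adic"
  is "\<lambda>x y n. (x n * y n) mod 2 ^ n"
  unfolding mod_two_power_Suc by (metis mod_mult_eq)

lemma res_simps:
  "res 0 n = 0" "res 1 n = 1 mod 2 ^ n"
  "res (x + y) n = (res x n + res y n) mod 2 ^ n"
  "res (x - y) n = (res x n - res y n) mod 2 ^ n"
  "res (- x) n = (- res x n) mod 2 ^ n"
  "res (x * y) n = (res x n * res y n) mod 2 ^ n"
  by (transfer, simp)+

instance
proof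
  fix a b c :: two_adic
  show "a * b * c = a * (b * c)"
    by (rule two_adic_eqI) (simp add: res_simps mod_simps ac_simps)
  show "a * b = b * a"
    by (rule two_adic_eqI) (simp add: res_simps mod_simps ac_simps)
  show "1 * a = a"
    by (rule two_adic_eqI) (simp add: res_simps mod_simps)
  show "a + b + c = a + (b + c)"
    by (rule two_adic_eqI) (simp add: res_simps mod_simps ac_simps)
  show "a + b = b + a"
    by (rule two_adic_eqI) (simp add: res_simps mod_simps ac_simps)
  show "0 + a = a"
    by (rule two_adic_eqI) (simp add: res_simps mod_simps)
  show "- a + a = 0"
    by (rule two_adic_eqI) (simp add: res_simps mod_simps)
  show "a - b = a + - b"
    by (rule two_adic_eqI) (simp add: res_simps mod_simps)
  show "(a + b) * c = a * c + b * c"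
    by (rule two_adic_eqI) (simp add: res_simps mod_simps algebra_simps)
  have "res (0 :: two_adic) 1 \<noteq> res 1 1"
    by (simp add: res_simps)
  then show "(0 :: two_adic) \<noteq> 1" by metis
qed

end

lemma res_of_nat: "res (of_nat k) n = int k mod 2 ^ n"
  by (induction k) (simp_all add: res_simps mod_simps ac_simps)

lemma res_of_int: "res (of_int k) n = k mod 2 ^ n"
  by (cases k rule: int_cases2) (simp_all add: res_simps res_of_nat mod_simps)

lemma res_sum: "res (sum f A) n = (\<Sum>x\<in>A. res (f x) n) mod 2 ^ n"
  by (induction A rule: infinite_finite_induct)
     (simp_all add: res_simps mod_simps)

lemma two_power_dvd_iff: "2 ^ k dvd x \<longleftrightarrow> res x k = 0"
proof
  assume "2 ^ k dvd x"
  then obtain y where y: "x = 2 ^ k * y" by (rule dvdE)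
  have "res (2 ^ k) k = 0"
    using res_of_int[of "2 ^ k" k] by simp
  then show "res x k = 0" by (simp add: y res_simps)
next
  assume x: "res x k = 0"
  define r where "r = (\<lambda>n. res x (n + k) div 2 ^ k)"
  have dvd: "2 ^ k dvd res x (n + k)" for n
    using res_mod_le[of k "n + k" x] x by (simp add: mod_eq_0_iff_dvd)
  have "r (Suc n) mod 2 ^ n = r n" for n
  proof -
    have "r (Suc n) mod 2 ^ n * 2 ^ k = (r (Suc n) * 2 ^ k) mod (2 ^ n * 2 ^ k)"
      by (simp add: mod_mult_mult2)
    also have "\<dots> = res x (Suc n + k) mod 2 ^ (n + k)"
      using dvd[of "Suc n"] by (simp add: r_def power_add)
    also have "\<dots> = res x (n + k)" by (rule res_mod_le) simp
    also have "\<dots> = r n * 2 ^ k" using dvd[of n] by (simp add: r_def)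
    finally show ?thesis by simp
  qed
  then have r: "res (Abs_two_adic r) = r"
    by (intro Abs_two_adic_inverse) blast
  have "x = 2 ^ k * Abs_two_adic r"
  proof (rule two_adic_eqI)
    fix n
    have "res (2 ^ k * Abs_two_adic r) n = (2 ^ k * r n) mod 2 ^ n"
      using res_of_int[of "2 ^ k" n] by (simp add: res_simps r mod_simps)
    also have "\<dots> = res x (n + k) mod 2 ^ n"
      using dvd[of n] by (simp add: r_def)
    also have "\<dots> = res x n" by (rule res_mod_le) simp
    finally show "res x n = res (2 ^ k * Abs_two_adic r) n" by simp
  qed
  then show "2 ^ k dvd x" by simp
qed

lemma two_power_dvd_diff_iff: "2 ^ k dvd x - y \<longleftrightarrow> res x k = res y k"
proof -
  have "2 ^ k dvd x - y \<longleftrightarrow> res x k mod 2 ^ k = res y k mod 2 ^ k"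
    unfolding two_power_dvd_iff by (simp only: res_simps mod_eq_dvd_iff mod_eq_0_iff_dvd)
  then show ?thesis by simp
qed

text \<open>
  The topology is that of the 2-adic absolute value; the exponent below is the 2-adic valuation
  of \<open>x - y\<close>.
\<close>

instantiation two_adic :: metric_space
begin

definition dist_two_adic :: "two_adic \<Rightarrow> two_adic \<Rightarrow> real" where
  "dist_two_adic x y =
     (if x = y then 0 else (1 / 2) ^ (LEAST n. \<not> 2 ^ Suc n dvd x - y))"

definition uniformity_two_adic :: "(two_adic \<times> two_adic) filter" where
  "uniformity_two_adic = (INF e\<in>{0<..}. principal {(x, y). dist x y < e})"

definition open_two_adic :: "two_adic set \<Rightarrow> bool" where
  "open_two_adic U \<longleftrightarrow> (\<forall>x\<in>U. eventually (\<lambda>(x', y). x' = x \<longrightarrow> y \<in> U) uniformity)"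

lemma dist_two_adic_le_iff: "dist x y \<le> (1 / 2) ^ n \<longleftrightarrow> res x n = res y n"
proof (cases "x = y")
  case True
  then show ?thesis by (simp add: dist_two_adic_def)
next
  case False
  define P where "P = (\<lambda>n. res x (Suc n) \<noteq> res y (Suc n))"
  obtain m where m: "res x m \<noteq> res y m" using False two_adic_eqI by blast
  then have "m \<noteq> 0" by (metis res_0)
  then have ex: "P (m - 1)" using m by (simp add: P_def)
  have d: "dist x y = (1 / 2) ^ Least P"
    using False by (simp add: dist_two_adic_def P_def two_power_dvd_diff_iff del: power_Suc)
  have "dist x y \<le> (1 / 2) ^ n \<longleftrightarrow> n \<le> Least P"
    unfolding d by (rule power_decreasing_iff) simp_all
  also have "\<dots> \<longleftrightarrow> res x n = res y n"
  proof
    assume n: "n \<le> Least P"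
    show "res x n = res y n"
    proof (cases n)
      case 0
      then show ?thesis by simp
    next
      case (Suc k)
      then have "\<not> P k" using n by (intro not_less_Least) simp
      then show ?thesis by (simp add: P_def Suc)
    qed
  next
    assume eq: "res x n = res y n"
    show "n \<le> Least P"
    proof (rule ccontr)
      assume "\<not> n \<le> Least P"
      then have "Suc (Least P) \<le> n" by simp
      then have "\<not> P (Least P)"
        unfolding P_def using eq by (metis res_mod_le)
      then show False using LeastI[of P, OF ex] by blast
    qed
  qed
  finally show ?thesis .
qed

lemma dist_two_adic_cases: "dist (x :: two_adic) y = 0 \<or> (\<exists>n. dist x y = (1 / 2) ^ n)"
  by (auto simp: dist_two_adic_def)

lemma dist_two_adic_nonneg: "0 \<le> dist (x :: two_adic) y"
  by (auto simp: dist_two_adic_def)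

lemma dist_two_adic_eq_0: "dist (x :: two_adic) y = 0 \<longleftrightarrow> x = y"
  by (auto simp: dist_two_adic_def)

instance
proof
  fix x y z :: two_adic
  show "dist x y = 0 \<longleftrightarrow> x = y" by (rule dist_two_adic_eq_0)
  have "dist x y \<le> max (dist x z) (dist y z)"
  proof (cases "max (dist x z) (dist y z) = 0")
    case True
    then have "dist x z = 0" "dist y z = 0"
      using dist_two_adic_nonneg[of x z] dist_two_adic_nonneg[of y z]
      by (auto simp: max_def split: if_splits)
    then have "x = y" by (simp add: dist_two_adic_eq_0)
    then have "dist x y = 0" by (simp only: dist_two_adic_eq_0)
    then show ?thesis using True by simp
  next
    case False
    then obtain n where n: "max (dist x z) (dist y z) = (1 / 2) ^ n"
      using dist_two_adic_cases[of x z] dist_two_adic_cases[of y z] by (metis max_def)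
    then have "dist x z \<le> (1 / 2) ^ n" "dist y z \<le> (1 / 2) ^ n" by linarith+
    then show ?thesis unfolding n dist_two_adic_le_iff by simp
  qed
  then show "dist x y \<le> dist x z + dist y z"
    using dist_two_adic_nonneg[of x z] dist_two_adic_nonneg[of y z] by linarith
qed (fact uniformity_two_adic_def open_two_adic_def)+

end

lemma tendsto_two_adic_iff:
  "Y \<longlonglongrightarrow> (L :: two_adic) \<longleftrightarrow> (\<forall>n. eventually (\<lambda>m. res (Y m) n = res L n) sequentially)"
proof
  assume lim: "Y \<longlonglongrightarrow> L"
  show "\<forall>n. eventually (\<lambda>m. res (Y m) n = res L n) sequentially"
  proof
    fix n
    have "eventually (\<lambda>m. dist (Y m) L < (1 / 2) ^ n) sequentially"
      using lim by (rule tendstoD) simp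
    then show "eventually (\<lambda>m. res (Y m) n = res L n) sequentially"
      by eventually_elim (simp add: dist_two_adic_le_iff[symmetric] del: power_divide)
  qed
next
  assume ev: "\<forall>n. eventually (\<lambda>m. res (Y m) n = res L n) sequentially"
  show "Y \<longlonglongrightarrow> L"
  proof (rule tendstoI)
    fix e :: real
    assume "0 < e"
    then obtain n where n: "(1 / 2) ^ n < e" using real_arch_pow_inv[of e "1 / 2"] by auto
    from ev have "eventually (\<lambda>m. res (Y m) n = res L n) sequentially" by blast
    then show "eventually (\<lambda>m. dist (Y m) L < e) sequentially"
    proof eventually_elim
      case (elim m)
      then have "dist (Y m) L \<le> (1 / 2) ^ n" unfolding dist_two_adic_le_iff .
      then show ?case using n by linarith
    qed
  qed
qed

lemma sums_two_adic: "\<exists>s. (\<lambda>i. 2 ^ i * c i :: two_adic) sums s \<and> (\<forall>n. 2 ^ n dvd s - (\<Sum>i<n. 2 ^ i * c i))"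
proof -
  define S where "S = (\<lambda>n. \<Sum>i<n. 2 ^ i * c i)"
  have step: "res (S m) n = res (S n) n" if "n \<le> m" for n m
    using that
  proof (induction m rule: dec_induct)
    case (step m)
    have "2 ^ n dvd (2 ^ m * c m)"
      using step.hyps by (simp add: le_imp_power_dvd)
    then have "2 ^ n dvd S (Suc m) - S m" by (simp add: S_def)
    then show ?case using step.IH unfolding two_power_dvd_diff_iff by simp
  qed simp
  have "res (S (Suc n)) (Suc n) mod 2 ^ n = res (S n) n" for n
    unfolding res_Suc by (rule step) simp
  then have s: "res (Abs_two_adic (\<lambda>n. res (S n) n)) = (\<lambda>n. res (S n) n)"
    by (intro Abs_two_adic_inverse) simp
  have "S \<longlonglongrightarrow> Abs_two_adic (\<lambda>n. res (S n) n)"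
    unfolding tendsto_two_adic_iff s using step eventually_sequentially by blast
  moreover have "2 ^ n dvd Abs_two_adic (\<lambda>n. res (S n) n) - S n" for n
    by (simp add: two_power_dvd_diff_iff s)
  ultimately show ?thesis unfolding sums_def S_def by blast
qed

lemma summable_two_adic: "summable (\<lambda>i. 2 ^ i * c i :: two_adic)"
  using sums_two_adic unfolding summable_def by blast

lemma suminf_two_adic: "2 ^ n dvd suminf (\<lambda>i. 2 ^ i * c i :: two_adic) - (\<Sum>i<n. 2 ^ i * c i)"
  using sums_two_adic[of c] sums_unique by metis


section \<open>Roots of unity and 2-adic exponents\<close>

definition primitive_root_of_unity :: "nat \<Rightarrow> 'a :: field \<Rightarrow> bool" where
  "primitive_root_of_unity n z \<longleftrightarrow> z ^ n = 1 \<and> (\<forall>k. 0 < k \<and> k < n \<longrightarrow> z ^ k \<noteq> 1)"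

definition two_power_root_of_unity :: "'a :: field \<Rightarrow> bool" where
  "two_power_root_of_unity z \<longleftrightarrow> (\<exists>k. z ^ (2 ^ k) = 1)"

text \<open>
  Meant for \<open>z\<close> a root of unity of order \<open>2 ^ k\<close>; the result does not depend on the choice of
  the integer, see \<open>two_adic_power_eq\<close>.
\<close>

definition two_adic_power :: "'a :: field \<Rightarrow> two_adic \<Rightarrow> 'a" where
  "two_adic_power z u =
     (let k = (THE k. primitive_root_of_unity (2 ^ k) z)
      in z powi (SOME u'. 2 ^ k dvd of_int u' - u))"

lemma two_adic_power_eq:
  assumes z: "primitive_root_of_unity (2 ^ k) z" and u: "2 ^ k dvd of_int u' - u"
  shows "two_adic_power z u = z powi u'"
proof -
  have uniq: "j = k" if j: "primitive_root_of_unity (2 ^ j) z" for j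
    using j z unfolding primitive_root_of_unity_def
    by (metis linorder_neqE_nat one_less_numeral_iff power_strict_increasing_iff
        semiring_norm(76) zero_less_numeral zero_less_power)
  have k: "(THE k. primitive_root_of_unity (2 ^ k) z) = k"
    by (rule the_equality) (fact z, rule uniq)
  define v where "v = (SOME u'. 2 ^ k dvd of_int u' - u)"
  have v: "2 ^ k dvd of_int v - u"
    unfolding v_def using u by (rule someI)
  then have "v mod 2 ^ k = u' mod 2 ^ k"
    using u unfolding two_power_dvd_diff_iff res_of_int by simp
  then obtain q where q: "v = u' + 2 ^ k * q"
    by (metis add_diff_cancel_left' diff_add_cancel dvdE mod_eq_dvd_iff)
  have one: "z ^ 2 ^ k = 1" using z by (simp add: primitive_root_of_unity_def)
  then have "z \<noteq> 0" by (intro notI) (simp add: zero_power)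
  then have "z powi v = z powi u' * (z powi (2 ^ k)) powi q"
    by (simp add: q power_int_add power_int_mult)
  also have "z powi (2 ^ k) = z ^ 2 ^ k"
    using power_int_of_nat[of z "2 ^ k"] by simp
  finally show ?thesis
    by (simp add: two_adic_power_def k v_def[symmetric] one)
qed


section \<open>The infinite binary rooted tree\<close>

datatype letter = a_letter (\<open>\<aa>\<close>) | b_letter (\<open>\<bb>\<close>)

type_synonym word = "letter list"

text \<open>The node \<open>w\<close> has the children \<open>w @ [\<aa>]\<close> and \<open>w @ [\<bb>]\<close>.\<close>

definition tree_Aut :: "(word \<Rightarrow> word) set" where
  "tree_Aut = {\<tau>. bij \<tau> \<and> \<tau> [] = [] \<and>
     (\<forall>w. {\<tau> (w @ [\<aa>]), \<tau> (w @ [\<bb>])} = {\<tau> w @ [\<aa>], \<tau> w @ [\<bb>]})}"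

text \<open>For \<open>\<tau> \<in> tree_Aut\<close> the second branch is the case in which \<open>\<tau>\<close> swaps.\<close>

definition Par :: "(word \<Rightarrow> word) \<Rightarrow> word \<Rightarrow> nat" where
  "Par \<tau> x = (if \<tau> (x @ [\<aa>]) = \<tau> x @ [\<aa>] \<and> \<tau> (x @ [\<bb>]) = \<tau> x @ [\<bb>] then 0 else 1)"

lemma Par_eq_1_iff:
  assumes "\<tau> \<in> tree_Aut"
  shows "Par \<tau> x = 1 \<longleftrightarrow> \<tau> (x @ [\<aa>]) = \<tau> x @ [\<bb>] \<and> \<tau> (x @ [\<bb>]) = \<tau> x @ [\<aa>]"
proof -
  have "{\<tau> (x @ [\<aa>]), \<tau> (x @ [\<bb>])} = {\<tau> x @ [\<aa>], \<tau> x @ [\<bb>]}"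
    using assms by (simp add: tree_Aut_def)
  then show ?thesis by (auto simp: Par_def doubleton_eq_iff)
qed

text \<open>\<open>ss = [s\<^sub>1, \<dots>, s\<^sub>i]\<close> gives the words \<open>a s\<^sub>1 a s\<^sub>2 \<dots> a s\<^sub>i\<close> and \<open>s\<^sub>1 a s\<^sub>2 a \<dots> s\<^sub>i a\<close>.\<close>

definition a_before :: "word \<Rightarrow> word" where
  "a_before ss = concat (map (\<lambda>s. [\<aa>, s]) ss)"

definition a_after :: "word \<Rightarrow> word" where
  "a_after ss = concat (map (\<lambda>s. [s, \<aa>]) ss)"

definition Q_sum :: "(word \<Rightarrow> word) \<Rightarrow> word \<Rightarrow> two_adic" where
  "Q_sum \<tau> x = (\<Sum>i. 2 ^ i * (\<Sum>ss | length ss = i. of_nat (Par \<tau> (x @ a_before ss))))"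

definition P_exp :: "(word \<Rightarrow> word) \<Rightarrow> word \<Rightarrow> two_adic" where
  "P_exp \<tau> x = (- 1) ^ Par \<tau> x
     + 2 * (\<Sum>t\<in>{\<aa>, \<bb>}. Q_sum \<tau> (x @ [\<bb>, t]))
     - 2 * (\<Sum>t\<in>{\<aa>, \<bb>}. Q_sum \<tau> (x @ [\<aa>, t]))"

lemma finite_words_of_length: "finite {ss :: word. length ss = i}"
proof -
  have "UNIV = {\<aa>, \<bb>}" using letter.exhaust by blast
  then have "finite (UNIV :: letter set)" by (metis finite.emptyI finite.insertI)
  then show ?thesis using finite_lists_length_eq[of UNIV i] by simp
qed


section \<open>Preimages under \<open>z\<^sup>2 - 1\<close> and the fields they generate\<close>

definition basilica :: "'a :: comm_ring_1 \<Rightarrow> 'a" where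
  "basilica z = z ^ 2 - 1"

definition preimages :: "'k :: field \<Rightarrow> nat \<Rightarrow> 'k alg_closure set" where
  "preimages x0 n = {z. (basilica ^^ n) z = to_ac x0}"

definition K_level :: "'k :: field \<Rightarrow> nat \<Rightarrow> 'k alg_closure set" where
  "K_level x0 n = generate_field ring_of_type_algebra (range to_ac \<union> preimages x0 n)"

definition K_infinity :: "'k :: field \<Rightarrow> 'k alg_closure set" where
  "K_infinity x0 = (\<Union>n. K_level x0 n)"

text \<open>
  Automorphisms of the subfield \<open>E\<close> that fix \<open>F\<close> pointwise, taken to be \<open>undefined\<close> outside
  of \<open>E\<close> so that each automorphism corresponds to exactly one function.
\<close>

definition Gal :: "'a :: field set \<Rightarrow> 'a set \<Rightarrow> ('a \<Rightarrow> 'a) set" where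
  "Gal E F = {\<sigma> \<in> extensional E.
     \<sigma> \<in> ring_iso (ring_of_type_algebra\<lparr>carrier := E\<rparr>) (ring_of_type_algebra\<lparr>carrier := E\<rparr>) \<and>
     (\<forall>x\<in>F. \<sigma> x = x)}"

definition G_infinity :: "'k :: field \<Rightarrow> ('k alg_closure \<Rightarrow> 'k alg_closure) set" where
  "G_infinity x0 = Gal (K_infinity x0) (range to_ac)"

text \<open>
  The target of the labeling is the disjoint union of the levels: for some \<open>x0\<close> (those periodic
  under \<open>basilica\<close>) the sets \<open>preimages x0 n\<close> overlap for different \<open>n\<close>. The node labeled by \<open>w\<close> is the
  pair \<open>(length w, lab w)\<close>.
\<close>

definition labeling :: "'k :: field \<Rightarrow> (word \<Rightarrow> 'k alg_closure) \<Rightarrow> bool" where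
  "labeling x0 lab \<longleftrightarrow>
     bij_betw (\<lambda>w. (length w, lab w)) UNIV (SIGMA n:UNIV. preimages x0 n) \<and>
     lab [] = to_ac x0 \<and>
     (\<forall>w. {lab (w @ [\<aa>]), lab (w @ [\<bb>])} = {z. basilica z = lab w})"

definition tree_action :: "(word \<Rightarrow> 'a) \<Rightarrow> ('a \<Rightarrow> 'a) \<Rightarrow> word \<Rightarrow> word" where
  "tree_action lab \<sigma> w = (THE v. length v = length w \<and> lab v = \<sigma> (lab w))"

lemma preimages_subset_K_infinity: "preimages x0 n \<subseteq> K_infinity x0"
  by (auto simp: K_infinity_def K_level_def intro!: generate_field.incl)

lemma to_ac_in_K_infinity: "to_ac x \<in> K_infinity x0"
  by (auto simp: K_infinity_def K_level_def intro!: generate_field.incl)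

lemma G_infinityD:
  assumes "\<sigma> \<in> G_infinity x0"
  shows "bij_betw \<sigma> (K_infinity x0) (K_infinity x0)"
    and "x \<in> K_infinity x0 \<Longrightarrow> y \<in> K_infinity x0 \<Longrightarrow> \<sigma> (x + y) = \<sigma> x + \<sigma> y"
    and "x \<in> K_infinity x0 \<Longrightarrow> y \<in> K_infinity x0 \<Longrightarrow> \<sigma> (x * y) = \<sigma> x * \<sigma> y"
    and "\<sigma> (to_ac k) = to_ac k"
  using assms unfolding G_infinity_def Gal_def ring_iso_def ring_hom_def
  by (auto simp: ring_of_type_algebra_def)

lemma labeling_parent:
  assumes "labeling x0 lab"
  shows "basilica (lab (w @ [s])) = lab w"
  using assms unfolding labeling_def by (cases s) blast+

lemma labeling_inj:
  assumes "labeling x0 lab" "length v = length w" "lab v = lab w"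
  shows "v = w"
  using assms unfolding labeling_def bij_betw_def inj_def by (metis prod.inject)

lemma labeling_in_K_infinity:
  assumes "labeling x0 lab"
  shows "lab w \<in> K_infinity x0"
proof -
  have "(length w, lab w) \<in> (SIGMA n:UNIV. preimages x0 n)"
    using assms unfolding labeling_def bij_betw_def by blast
  then show ?thesis using preimages_subset_K_infinity by blast
qed

lemma G_infinity_f:
  assumes "\<sigma> \<in> G_infinity x0" "z \<in> K_infinity x0" "basilica z \<in> K_infinity x0"
  shows "\<sigma> (basilica z) = basilica (\<sigma> z)"
proof -
  have "z * z = basilica z + to_ac 1" by (simp add: basilica_def power2_eq_square)
  then have "\<sigma> z * \<sigma> z = \<sigma> (basilica z) + to_ac 1"
    using assms G_infinityD[OF assms(1)] to_ac_in_K_infinity by metis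
  then show ?thesis by (simp add: basilica_def power2_eq_square)
qed

lemma tree_action_Ex:
  assumes \<sigma>: "\<sigma> \<in> G_infinity x0" and lab: "labeling x0 lab"
  shows "\<exists>v. length v = length w \<and> lab v = \<sigma> (lab w)"
proof (induction w rule: rev_induct)
  case Nil
  then show ?case using lab G_infinityD(4)[OF \<sigma>] by (auto simp: labeling_def)
next
  case (snoc s w)
  then obtain v where v: "length v = length w" "lab v = \<sigma> (lab w)" by blast
  have "basilica (\<sigma> (lab (w @ [s]))) = lab v"
    using G_infinity_f[OF \<sigma>, of "lab (w @ [s])"] labeling_parent[OF lab]
      labeling_in_K_infinity[OF lab] v by simp
  then have "\<sigma> (lab (w @ [s])) \<in> {lab (v @ [\<aa>]), lab (v @ [\<bb>])}"
    using lab by (simp add: labeling_def)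
  then obtain t where "\<sigma> (lab (w @ [s])) = lab (v @ [t])" by blast
  then show ?case using v by (intro exI[of _ "v @ [t]"]) simp
qed

lemma tree_action:
  assumes \<sigma>: "\<sigma> \<in> G_infinity x0" and lab: "labeling x0 lab"
  shows "length (tree_action lab \<sigma> w) = length w" "lab (tree_action lab \<sigma> w) = \<sigma> (lab w)"
proof -
  have "\<exists>!v. length v = length w \<and> lab v = \<sigma> (lab w)"
    using tree_action_Ex[OF assms] labeling_inj[OF lab] by metis
  from theI'[OF this]
  show "length (tree_action lab \<sigma> w) = length w" "lab (tree_action lab \<sigma> w) = \<sigma> (lab w)"
    unfolding tree_action_def by blast+
qed

lemma tree_action_in_tree_Aut:
  assumes \<sigma>: "\<sigma> \<in> G_infinity x0" and lab: "labeling x0 lab"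
  shows "tree_action lab \<sigma> \<in> tree_Aut"
proof -
  define \<tau> where "\<tau> = tree_action lab \<sigma>"
  note \<tau> = tree_action[OF assms, folded \<tau>_def]
  have nil: "\<tau> [] = []" using \<tau>(1)[of "[]"] by simp
  have inj: "inj \<tau>"
  proof (rule injI)
    fix v w assume eq: "\<tau> v = \<tau> w"
    then have "\<sigma> (lab v) = \<sigma> (lab w)" using \<tau>(2) by metis
    then have "lab v = lab w"
      using G_infinityD(1)[OF \<sigma>] labeling_in_K_infinity[OF lab]
      unfolding bij_betw_def inj_on_def by blast
    moreover have "length v = length w" using eq \<tau>(1) by metis
    ultimately show "v = w" using labeling_inj[OF lab] by blast
  qed
  have child: "\<exists>t. \<tau> (w @ [s]) = \<tau> w @ [t]" for w s
  proof -
    obtain v t where vt: "\<tau> (w @ [s]) = v @ [t]"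
      using \<tau>(1)[of "w @ [s]"] by (cases "\<tau> (w @ [s])" rule: rev_cases) auto
    have "lab v = basilica (lab (\<tau> (w @ [s])))" by (simp add: vt labeling_parent[OF lab])
    also have "\<dots> = \<sigma> (lab w)"
      using G_infinity_f[OF \<sigma>, of "lab (w @ [s])"] labeling_parent[OF lab]
        labeling_in_K_infinity[OF lab] \<tau>(2) by simp
    finally have "lab v = lab (\<tau> w)" by (simp add: \<tau>(2))
    moreover have "length v = length (\<tau> w)"
      using \<tau>(1)[of "w @ [s]"] \<tau>(1)[of w] vt by simp
    ultimately have "v = \<tau> w" using labeling_inj[OF lab] by blast
    then show ?thesis using vt by blast
  qed
  have children: "{\<tau> (w @ [\<aa>]), \<tau> (w @ [\<bb>])} = {\<tau> w @ [\<aa>], \<tau> w @ [\<bb>]}" for w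
  proof -
    obtain s t where st: "\<tau> (w @ [\<aa>]) = \<tau> w @ [s]" "\<tau> (w @ [\<bb>]) = \<tau> w @ [t]"
      using child by metis
    then have "s \<noteq> t" using inj by (metis injD letter.distinct(1) last_snoc)
    then show ?thesis unfolding st by (cases s; cases t) auto
  qed
  have "v \<in> range \<tau>" for v
  proof (induction v rule: rev_induct)
    case Nil
    then show ?case using nil by (metis rangeI)
  next
    case (snoc s v)
    then obtain w where "v = \<tau> w" by blast
    then have "v @ [s] \<in> {\<tau> (w @ [\<aa>]), \<tau> (w @ [\<bb>])}"
      unfolding children by (cases s) auto
    then show ?case by blast
  qed
  then have "bij \<tau>" using inj by (auto simp: bij_def)
  then show ?thesis using nil children by (simp add: tree_Aut_def \<tau>_def[symmetric])
qed

end

theory Submission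
  imports Defs
begin

text \<open>
  Up to a power of \<open>\<zeta>\<^bsub>2^i\<^esub>\<close> that counts the swaps of \<open>\<sigma>\<close> below \<open>x\<close>, the automorphism \<open>\<sigma>\<close> maps the
  product of all \<open>[x s\<^sub>1 a s\<^sub>2 a \<dots> s\<^sub>i a]\<close> to the same product formed at \<open>\<sigma> x\<close>: going from \<open>i\<close> to
  \<open>i + 1\<close>, each swap at \<open>x s\<close> contributes one factor \<open>\<zeta>\<^bsub>2^(i+1)\<^esub>\<close> by the assumption on the labeling.
  The counts are the partial sums of the series \<open>Q\<close>. Applying this to \<open>x = y a\<close> and \<open>x = y b\<close> and
  dividing computes \<open>\<sigma>(\<zeta>\<^bsub>2^(i+1)\<^esub>)\<close>.
\<close>

section \<open>Powers of primitive roots of unity\<close>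

lemma primitive_root_of_unity_power_eq_1_iff:
  assumes z: "primitive_root_of_unity n z" and n: "0 < n"
  shows "z ^ k = 1 \<longleftrightarrow> n dvd k"
proof -
  have one: "z ^ n = 1" using z by (simp add: primitive_root_of_unity_def)
  have "z ^ k = z ^ (n * (k div n) + k mod n)" by simp
  also have "\<dots> = z ^ (k mod n)" by (simp only: power_add power_mult one power_one mult_1_left)
  finally have eq: "z ^ k = z ^ (k mod n)" .
  have "z ^ (k mod n) = 1 \<longleftrightarrow> k mod n = 0"
    using z n unfolding primitive_root_of_unity_def
    by (metis bot_nat_0.not_eq_extremum mod_less_divisor power_0)
  then show ?thesis by (simp add: eq mod_eq_0_iff_dvd)
qed

text \<open>The powers \<open>z ^ j\<close> with \<open>j < n\<close> are \<open>n\<close> distinct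
  roots of X^n - 1, which has at most \<open>n\<close> roots, so they are all of them.\<close>

lemma root_of_unity_eq_power_primitive:
  fixes z :: "'a :: field"
  assumes z: "primitive_root_of_unity n z" and n: "0 < n" and x: "x ^ n = 1"
  shows "\<exists>j. x = z ^ j"
proof -
  define p where "p = monom (1 :: 'a) n - 1"
  have poly_p: "poly p y = y ^ n - 1" for y by (simp add: p_def poly_monom)
  have "coeff p n = 1" using n by (simp add: p_def)
  then have p0: "p \<noteq> 0" by auto
  have deg: "degree p \<le> n"
    unfolding p_def by (rule degree_diff_le) (simp_all add: degree_monom_le)
  have nz: "z \<noteq> 0" using z n by (auto simp: primitive_root_of_unity_def zero_power)
  have "inj_on (\<lambda>j. z ^ j) {..<n}"
  proof (rule linorder_inj_onI)
    fix i j assume ij: "i < j" "i \<in> {..<n}" "j \<in> {..<n}"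
    have "z ^ (j - i) \<noteq> 1"
      using z ij unfolding primitive_root_of_unity_def by auto
    moreover have "z ^ j = z ^ i * z ^ (j - i)" using ij by (simp flip: power_add)
    ultimately show "z ^ i \<noteq> z ^ j" using nz by simp
  qed auto
  then have "card ((\<lambda>j. z ^ j) ` {..<n}) = n" by (simp add: card_image)
  moreover have "(z ^ j) ^ n = 1" for j
    using z unfolding primitive_root_of_unity_def by (metis mult.commute power_mult power_one)
  then have "(\<lambda>j. z ^ j) ` {..<n} \<subseteq> {y. poly p y = 0}"
    by (auto simp: poly_p)
  moreover have "card {y. poly p y = 0} \<le> n"
    using card_poly_roots_bound[OF p0] deg by linarith
  ultimately have "(\<lambda>j. z ^ j) ` {..<n} = {y. poly p y = 0}"
    using poly_roots_finite[OF p0] by (intro card_seteq) auto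
  then show ?thesis using x by (auto simp: poly_p)
qed

text \<open>\<open>two_adic_power\<close> is evaluated through the exact order of its base, so being
  killed by some power of 2 has to be sharpened to having order exactly \<open>2 ^ m\<close>. For
  the least possible \<open>m\<close>, either \<open>m = 0\<close> or \<open>x\<close> is an odd
  power of \<open>zeta m\<close>.\<close>

lemma two_power_root_of_unity_primitive:
  fixes x :: "'a :: field"
  assumes zeta: "\<And>m. primitive_root_of_unity (2 ^ m) (zeta m :: 'a)"
    and x: "two_power_root_of_unity x"
  shows "\<exists>m. primitive_root_of_unity (2 ^ m) x"
proof -
  define m where "m = (LEAST k. x ^ (2 ^ k) = 1)"
  have m: "x ^ (2 ^ m) = 1"
    using x unfolding two_power_root_of_unity_def m_def by (metis (mono_tags, lifting) LeastI_ex)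
  obtain j where j: "x = zeta m ^ j"
    using root_of_unity_eq_power_primitive[OF zeta _ m] by auto
  have iff: "x ^ k = 1 \<longleftrightarrow> 2 ^ m dvd j * k" for k
    using primitive_root_of_unity_power_eq_1_iff[OF zeta] by (simp add: j flip: power_mult)
  have "2 ^ m dvd k" if k: "x ^ k = 1" for k
  proof (cases m)
    case (Suc l)
    \<comment> \<open>For even \<open>j\<close> already the exponent \<open>2 ^ l\<close> would kill
      \<open>x\<close>, against the minimality of \<open>m = Suc l\<close>. Oddness then lets
      \<open>2 ^ m dvd j * k\<close> pass to \<open>k\<close>.\<close>
    have "odd j"
    proof
      assume "even j"
      then have "2 ^ m dvd j * 2 ^ l" by (auto simp: Suc)
      then have "x ^ 2 ^ l = 1" by (simp add: iff)
      then have "m \<le> l" unfolding m_def by (rule Least_le)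
      then show False using Suc by simp
    qed
    then have "coprime (2 ^ m) j" by simp
    then show ?thesis using k iff coprime_dvd_mult_right_iff by blast
  qed simp
  then have "primitive_root_of_unity (2 ^ m) x"
    unfolding primitive_root_of_unity_def using m nat_dvd_not_less by blast
  then show ?thesis by blast
qed


section \<open>Sums and products over words\<close>

lemma words_Suc:
  "{ss :: word. length ss = Suc i} = (#) \<aa> ` {ss. length ss = i} \<union> (#) \<bb> ` {ss. length ss = i}"
  by (auto simp: length_Suc_conv image_iff) (metis letter.exhaust)

lemma prod_words_Suc:
  fixes g :: "word \<Rightarrow> 'a :: comm_monoid_mult"
  shows "(\<Prod>ss | length ss = Suc i. g ss) =
    (\<Prod>ss | length ss = i. g (\<aa> # ss)) * (\<Prod>ss | length ss = i. g (\<bb> # ss))"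
  unfolding words_Suc
  by (subst prod.union_disjoint) (auto simp: finite_words_of_length prod.reindex)

lemma sum_words_Suc:
  fixes g :: "word \<Rightarrow> 'a :: comm_monoid_add"
  shows "(\<Sum>ss | length ss = Suc i. g ss) =
    (\<Sum>ss | length ss = i. g (\<aa> # ss)) + (\<Sum>ss | length ss = i. g (\<bb> # ss))"
  unfolding words_Suc
  by (subst sum.union_disjoint) (auto simp: finite_words_of_length sum.reindex)

text \<open>Truncation of \<open>Q_sum\<close> kept in the natural numbers, so that it can serve as
  an ordinary exponent.\<close>

definition Q_partial :: "(word \<Rightarrow> word) \<Rightarrow> nat \<Rightarrow> word \<Rightarrow> nat" where
  "Q_partial \<tau> n x = (\<Sum>i<n. 2 ^ i * (\<Sum>ss | length ss = i. Par \<tau> (x @ a_before ss)))"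

lemma Q_partial_0 [simp]: "Q_partial \<tau> 0 x = 0"
  by (simp add: Q_partial_def)

text \<open>The term of index 0 is split off, and in the others the first letter of each word. This
  is the recursion that the induction in \<open>label_prod_image\<close> follows.\<close>

lemma Q_partial_Suc:
  "Q_partial \<tau> (Suc n) x =
    Par \<tau> x + 2 * (Q_partial \<tau> n (x @ [\<aa>, \<aa>]) + Q_partial \<tau> n (x @ [\<aa>, \<bb>]))"
  unfolding Q_partial_def sum.lessThan_Suc_shift
  by (simp add: sum_words_Suc a_before_def sum_distrib_left sum.distrib algebra_simps)

lemma Q_sum_dvd: "2 ^ n dvd Q_sum \<tau> x - of_nat (Q_partial \<tau> n x)"
  using suminf_two_adic[of n "\<lambda>i. \<Sum>ss | length ss = i. of_nat (Par \<tau> (x @ a_before ss))"]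
  by (simp add: Q_sum_def Q_partial_def)

definition P_partial :: "(word \<Rightarrow> word) \<Rightarrow> nat \<Rightarrow> word \<Rightarrow> int" where
  "P_partial \<tau> n x = (- 1) ^ Par \<tau> x
     + 2 * int (\<Sum>t\<in>{\<aa>, \<bb>}. Q_partial \<tau> n (x @ [\<bb>, t]))
     - 2 * int (\<Sum>t\<in>{\<aa>, \<bb>}. Q_partial \<tau> n (x @ [\<aa>, t]))"

text \<open>The factors 2 in front of the \<open>Q\<close> sums gain one power of 2 over
  \<open>Q_sum_dvd\<close>. The modulus \<open>2 ^ Suc n\<close> is the order of the root of unity
  to which the exponent \<open>P_partial \<tau> n x\<close> is applied in
  \<open>G_infinity_zeta\<close>.\<close>

lemma P_exp_dvd: "2 ^ Suc n dvd of_int (P_partial \<tau> n x) - P_exp \<tau> x"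
proof -
  define d where "d = (\<lambda>w. Q_sum \<tau> w - of_nat (Q_partial \<tau> n w))"
  have "of_int (P_partial \<tau> n x) - P_exp \<tau> x =
    2 * (d (x @ [\<aa>, \<aa>]) + d (x @ [\<aa>, \<bb>]) - d (x @ [\<bb>, \<aa>]) - d (x @ [\<bb>, \<bb>]))"
    by (simp add: P_partial_def P_exp_def d_def algebra_simps)
  moreover have "2 ^ n dvd d w" for w unfolding d_def by (rule Q_sum_dvd)
  ultimately show ?thesis by (simp add: mult_dvd_mono)
qed


section \<open>The Galois action on products of labels\<close>

lemma K_level_mult: "x \<in> K_level x0 n \<Longrightarrow> y \<in> K_level x0 n \<Longrightarrow> x * y \<in> K_level x0 n"
  unfolding K_level_def
  using generate_field.eng_mult[of x ring_of_type_algebra _ y]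
  by (simp add: ring_of_type_algebra_def)

lemma K_level_one: "1 \<in> K_level x0 n"
  unfolding K_level_def
  using generate_field.one[of ring_of_type_algebra]
  by (simp add: ring_of_type_algebra_def)

lemma K_level_power: "x \<in> K_level x0 n \<Longrightarrow> x ^ j \<in> K_level x0 n"
  by (induction j) (auto simp: K_level_one K_level_mult)

lemma K_level_prod: "(\<And>i. i \<in> A \<Longrightarrow> f i \<in> K_level x0 n) \<Longrightarrow> prod f A \<in> K_level x0 n"
  by (induction A rule: infinite_finite_induct) (auto simp: K_level_one K_level_mult)

lemma G_infinity_power:
  assumes "\<sigma> \<in> G_infinity x0" "x \<in> K_infinity x0"
  shows "\<sigma> (x ^ j) = \<sigma> x ^ j"
proof (induction j)
  case 0
  then show ?case using G_infinityD(4)[OF assms(1), of 1] by simp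
next
  case (Suc j)
  have "x ^ j \<in> K_infinity x0" using assms(2) K_level_power unfolding K_infinity_def by blast
  then show ?case using G_infinityD(3)[OF assms(1,2)] Suc by simp
qed

lemma labeling_in_K_level:
  assumes "labeling x0 lab"
  shows "lab w \<in> K_level x0 (length w)"
proof -
  have "(length w, lab w) \<in> (SIGMA n:UNIV. preimages x0 n)"
    using assms unfolding labeling_def bij_betw_def by blast
  then show ?thesis by (auto simp: K_level_def intro: generate_field.incl)
qed

definition label_prod :: "(word \<Rightarrow> 'a :: field) \<Rightarrow> nat \<Rightarrow> word \<Rightarrow> 'a" where
  "label_prod lab i x = (\<Prod>ss | length ss = i. lab (x @ a_after ss))"

lemma label_prod_0 [simp]: "label_prod lab 0 x = lab x"
  by (simp add: label_prod_def a_after_def)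

lemma label_prod_Suc:
  "label_prod lab (Suc i) x = label_prod lab i (x @ [\<aa>, \<aa>]) * label_prod lab i (x @ [\<bb>, \<aa>])"
  by (simp add: label_prod_def prod_words_Suc a_after_def)

text \<open>All factors are labels of words of the same length \<open>length x + 2 * i\<close>,
  hence lie in a single \<open>K_level\<close>, which is closed under products.\<close>

lemma label_prod_in_K_infinity:
  assumes "labeling x0 lab"
  shows "label_prod lab i x \<in> K_infinity x0"
proof -
  have len: "length (a_after ss) = 2 * length ss" for ss
    by (induction ss) (simp_all add: a_after_def)
  have "lab (x @ a_after ss) \<in> K_level x0 (length x + 2 * i)" if "length ss = i" for ss
    using labeling_in_K_level[OF assms, of "x @ a_after ss"] by (simp add: len that)
  then have "label_prod lab i x \<in> K_level x0 (length x + 2 * i)"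
    unfolding label_prod_def by (intro K_level_prod) simp
  then show ?thesis by (auto simp: K_infinity_def)
qed

lemma tree_Aut_children:
  assumes "\<tau> \<in> tree_Aut"
  shows "\<tau> (x @ [\<aa>]) = \<tau> x @ [\<aa>] \<and> \<tau> (x @ [\<bb>]) = \<tau> x @ [\<bb>] \<and> Par \<tau> x = 0 \<or>
    \<tau> (x @ [\<aa>]) = \<tau> x @ [\<bb>] \<and> \<tau> (x @ [\<bb>]) = \<tau> x @ [\<aa>] \<and> Par \<tau> x = 1"
proof (cases "Par \<tau> x = 1")
  case True
  then show ?thesis using Par_eq_1_iff[OF assms] by simp
next
  case False
  then show ?thesis by (auto simp: Par_def split: if_splits)
qed

text \<open>Induction on \<open>i\<close>, treating the two children of \<open>x\<close> separately.
  The counts start at these children because a swap at \<open>x\<close> itself only exchanges the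
  two halves of the product.\<close>

lemma label_prod_image:
  assumes \<sigma>: "\<sigma> \<in> G_infinity x0" and lab: "labeling x0 lab"
    and zeta_square: "\<And>m. m \<ge> 1 \<Longrightarrow> zeta m ^ 2 = zeta (m - 1)"
    and prods: "\<And>y i. label_prod lab i (y @ [\<aa>]) = label_prod lab i (y @ [\<bb>]) * zeta (i + 1)"
  defines "\<tau> \<equiv> tree_action lab \<sigma>"
  shows "\<sigma> (label_prod lab i x) *
      zeta i ^ (Q_partial \<tau> i (x @ [\<aa>]) + Q_partial \<tau> i (x @ [\<bb>])) =
    label_prod lab i (\<tau> x)"
proof (induction i arbitrary: x)
  case 0
  show ?case by (simp add: \<tau>_def tree_action[OF \<sigma> lab])
next
  case (Suc i)
  note aut = tree_action_in_tree_Aut[OF \<sigma> lab, folded \<tau>_def]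
  have child: "\<sigma> (label_prod lab i (w @ [\<aa>])) * zeta (Suc i) ^ Q_partial \<tau> (Suc i) w =
    label_prod lab i (\<tau> w @ [\<aa>])" for w
  proof -
    \<comment> \<open>The factor 2 in \<open>Q_partial_Suc\<close> squares
      \<open>zeta (Suc i)\<close> to \<open>zeta i\<close>, which leaves exactly the power in the
      induction hypothesis at \<open>w @ [\<aa>]\<close>.\<close>
    have "zeta (Suc i) ^ Q_partial \<tau> (Suc i) w = zeta (Suc i) ^ Par \<tau> w *
      zeta i ^ (Q_partial \<tau> i (w @ [\<aa>, \<aa>]) + Q_partial \<tau> i (w @ [\<aa>, \<bb>]))"
      using zeta_square[of "Suc i"] by (simp only: Q_partial_Suc power_add power_mult) simp
    then have "\<sigma> (label_prod lab i (w @ [\<aa>])) * zeta (Suc i) ^ Q_partial \<tau> (Suc i) w =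
      label_prod lab i (\<tau> (w @ [\<aa>])) * zeta (Suc i) ^ Par \<tau> w"
      using Suc.IH[of "w @ [\<aa>]"] by (simp add: mult_ac)
    \<comment> \<open>If \<open>\<sigma>\<close> swaps below \<open>w\<close>, the product sits at
      \<open>\<tau> w @ [\<bb>]\<close>, and \<open>prods\<close> trades it for the one at
      \<open>\<tau> w @ [\<aa>]\<close> at the cost of one factor
      \<open>zeta (Suc i)\<close>.\<close>
    also have "\<dots> = label_prod lab i (\<tau> w @ [\<aa>])"
      using tree_Aut_children[OF aut, of w] prods[of i "\<tau> w"] by auto
    finally show ?thesis .
  qed
  have "\<sigma> (label_prod lab (Suc i) x) =
    \<sigma> (label_prod lab i (x @ [\<aa>, \<aa>])) * \<sigma> (label_prod lab i (x @ [\<bb>, \<aa>]))"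
    unfolding label_prod_Suc by (intro G_infinityD(3)[OF \<sigma>] label_prod_in_K_infinity[OF lab])
  then have "\<sigma> (label_prod lab (Suc i) x) *
      zeta (Suc i) ^ (Q_partial \<tau> (Suc i) (x @ [\<aa>]) + Q_partial \<tau> (Suc i) (x @ [\<bb>])) =
    label_prod lab i (\<tau> (x @ [\<aa>]) @ [\<aa>]) * label_prod lab i (\<tau> (x @ [\<bb>]) @ [\<aa>])"
    unfolding child[symmetric] by (simp add: power_add mult_ac)
  also have "\<dots> = label_prod lab (Suc i) (\<tau> x)"
    unfolding label_prod_Suc using tree_Aut_children[OF aut, of x] by (auto simp: mult_ac)
  finally show ?case .
qed

text \<open>Applying \<open>\<sigma>\<close> to \<open>prods\<close> at \<open>y\<close> expresses
  \<open>\<sigma> z\<close> as the quotient of two transformed products. By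
  \<open>label_prod_image\<close> they are, up to powers of \<open>zeta i = z ^ 2\<close>, the
  products at the two children of \<open>\<tau> y\<close>, whose quotient is \<open>z\<close> or its
  inverse according to \<open>Par \<tau> y\<close>. The squares account for the coefficients 2 in
  \<open>P_partial\<close>.\<close>

lemma G_infinity_zeta:
  assumes \<sigma>: "\<sigma> \<in> G_infinity x0" and lab: "labeling x0 lab"
    and zeta_nz: "\<And>m. zeta m \<noteq> 0"
    and zeta_in: "\<And>m. zeta m \<in> K_infinity x0"
    and zeta_square: "\<And>m. m \<ge> 1 \<Longrightarrow> zeta m ^ 2 = zeta (m - 1)"
    and prods_nz: "\<And>y i. label_prod lab i (y @ [\<bb>]) \<noteq> 0"
    and prods: "\<And>y i. label_prod lab i (y @ [\<aa>]) = label_prod lab i (y @ [\<bb>]) * zeta (i + 1)"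
  defines "\<tau> \<equiv> tree_action lab \<sigma>"
  shows "\<sigma> (zeta (Suc i)) = zeta (Suc i) powi P_partial \<tau> i y"
proof -
  define z where "z = zeta (Suc i)"
  define A B where "A = \<sigma> (label_prod lab i (y @ [\<aa>]))" and "B = \<sigma> (label_prod lab i (y @ [\<bb>]))"
  define q where "q = (\<lambda>c. Q_partial \<tau> i (y @ [c, \<aa>]) + Q_partial \<tau> i (y @ [c, \<bb>]))"
  note aut = tree_action_in_tree_Aut[OF \<sigma> lab, folded \<tau>_def]
  have z0: "z \<noteq> 0" unfolding z_def by (rule zeta_nz)
  have "zeta i = z ^ 2" using zeta_square[of "Suc i"] by (simp add: z_def)
  then have q: "A * z ^ (2 * q \<aa>) = label_prod lab i (\<tau> (y @ [\<aa>]))"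
    "B * z ^ (2 * q \<bb>) = label_prod lab i (\<tau> (y @ [\<bb>]))"
    using label_prod_image[OF \<sigma> lab zeta_square prods, of i "y @ [\<aa>]", folded \<tau>_def]
      label_prod_image[OF \<sigma> lab zeta_square prods, of i "y @ [\<bb>]", folded \<tau>_def]
    by (simp_all only: A_def B_def q_def power_mult append.simps append_assoc)
  have AB: "A = B * \<sigma> z"
    unfolding A_def B_def z_def prods
    using G_infinityD(3)[OF \<sigma> label_prod_in_K_infinity[OF lab] zeta_in] by simp
  have prods': "label_prod lab i (\<tau> y @ [\<aa>]) = label_prod lab i (\<tau> y @ [\<bb>]) * z"
    using prods by (simp add: z_def)
  have P: "z powi P_partial \<tau> i y = z powi ((- 1) ^ Par \<tau> y) * z ^ (2 * q \<bb>) / z ^ (2 * q \<aa>)"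
  proof -
    have "P_partial \<tau> i y = (- 1) ^ Par \<tau> y + int (2 * q \<bb>) - int (2 * q \<aa>)"
      by (simp add: P_partial_def q_def)
    then show ?thesis using z0 by (simp only: power_int_add power_int_diff power_int_of_nat simp_thms)
  qed
  \<comment> \<open>Up to a power of \<open>z\<close>, \<open>B\<close> is the product at a child of
    \<open>\<tau> y\<close>. At the b-child it is nonzero by \<open>prods_nz\<close>, at the a-child
    it is \<open>z\<close> times that one.\<close>
  have "B \<noteq> 0"
    using q(2) tree_Aut_children[OF aut, of y] prods_nz[of i "\<tau> y"] prods' z0 by auto
  moreover have "B * (\<sigma> z * z ^ (2 * q \<aa>)) = B * (z powi ((- 1) ^ Par \<tau> y) * z ^ (2 * q \<bb>))"
    using tree_Aut_children[OF aut, of y]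
  proof (elim disjE conjE)
    assume "\<tau> (y @ [\<aa>]) = \<tau> y @ [\<aa>]" "\<tau> (y @ [\<bb>]) = \<tau> y @ [\<bb>]" "Par \<tau> y = 0"
    then show ?thesis using q prods' AB by (simp add: mult_ac)
  next
    assume "\<tau> (y @ [\<aa>]) = \<tau> y @ [\<bb>]" "\<tau> (y @ [\<bb>]) = \<tau> y @ [\<aa>]" "Par \<tau> y = 1"
    then show ?thesis using q prods' AB z0 by (simp add: field_simps)
  qed
  ultimately have "\<sigma> z * z ^ (2 * q \<aa>) = z powi ((- 1) ^ Par \<tau> y) * z ^ (2 * q \<bb>)" by simp
  then have "\<sigma> z = z powi P_partial \<tau> i y"
    unfolding P using z0 by (simp add: eq_divide_eq)
  then show ?thesis by (simp add: z_def)
qed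

theorem theorem2p2:
  fixes x0 :: "'k :: field"
    and zeta :: "nat \<Rightarrow> 'k alg_closure"
    and lab :: "word \<Rightarrow> 'k alg_closure"
  assumes char: "CHAR('k) \<noteq> 2"
    and x0: "x0 \<noteq> 0" "x0 \<noteq> - 1"
    and zeta_primitive: "\<And>m. primitive_root_of_unity (2 ^ m) (zeta m)"
    and zeta_in: "\<And>m. zeta m \<in> K_infinity x0"
    and zeta_square: "\<And>m. m \<ge> 1 \<Longrightarrow> zeta m ^ 2 = zeta (m - 1)"
    and labeling: "labeling x0 lab"
    and label_products: "\<And>y i.
      (\<Prod>ss | length ss = i. lab (y @ [\<aa>] @ a_after ss)) *
      inverse (\<Prod>ss | length ss = i. lab (y @ [\<bb>] @ a_after ss)) = zeta (i + 1)"
  shows "\<forall>y. \<forall>\<xi>\<in>K_infinity x0. two_power_root_of_unity \<xi> \<longrightarrow>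
    (\<forall>\<sigma>\<in>G_infinity x0. \<sigma> \<xi> = two_adic_power \<xi> (P_exp (tree_action lab \<sigma>) y))"
proof (intro allI ballI impI)
  fix y and \<xi> :: "'k alg_closure" and \<sigma>
  assume \<xi>: "two_power_root_of_unity \<xi>" and \<sigma>: "\<sigma> \<in> G_infinity x0"
  define \<tau> where "\<tau> = tree_action lab \<sigma>"
  have zeta_nz: "zeta m \<noteq> 0" for m
    using zeta_primitive[of m] by (auto simp: primitive_root_of_unity_def zero_power)
  have prods: "label_prod lab i (w @ [\<aa>]) * inverse (label_prod lab i (w @ [\<bb>])) = zeta (i + 1)"
    for w i using label_products[of w i] by (simp add: label_prod_def)
  \<comment> \<open>Since \<open>inverse 0 = 0\<close>, a vanishing denominator would force
    \<open>zeta (i + 1) = 0\<close>.\<close>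
  have prods_nz: "label_prod lab i (w @ [\<bb>]) \<noteq> 0" for w i
    using prods[of i w] zeta_nz by auto
  have prods': "label_prod lab i (w @ [\<aa>]) = label_prod lab i (w @ [\<bb>]) * zeta (i + 1)" for w i
    using prods[of i w, symmetric] prods_nz[of i w] by simp
  obtain m where m: "primitive_root_of_unity (2 ^ m) \<xi>"
    using two_power_root_of_unity_primitive[OF zeta_primitive \<xi>] by blast
  \<comment> \<open>\<open>G_infinity_zeta\<close> speaks of the roots \<open>zeta (Suc i)\<close>
    only; passing from \<open>m\<close> to \<open>Suc m\<close> also covers
    \<open>\<xi> = 1\<close>, where \<open>m = 0\<close>.\<close>
  then have "\<xi> ^ 2 ^ Suc m = 1"
    by (simp add: primitive_root_of_unity_def power_mult mult.commute[of 2])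
  then obtain j where j: "\<xi> = zeta (Suc m) ^ j"
    using root_of_unity_eq_power_primitive[OF zeta_primitive] by (metis zero_less_numeral zero_less_power)
  define e where "e = P_partial \<tau> m y"
  have "\<sigma> \<xi> = (zeta (Suc m) powi e) ^ j"
    unfolding j G_infinity_power[OF \<sigma> zeta_in] e_def \<tau>_def
    using G_infinity_zeta[OF \<sigma> labeling zeta_nz zeta_in zeta_square prods_nz prods'] by simp
  also have "\<dots> = \<xi> powi e"
    by (simp add: j mult.commute flip: power_int_of_nat power_int_mult)
  \<comment> \<open>\<open>P_exp_dvd\<close> controls \<open>e\<close> modulo
    \<open>2 ^ Suc m\<close>, hence modulo the order \<open>2 ^ m\<close> of \<open>\<xi>\<close>,
    so \<open>e\<close> is an admissible integer exponent.\<close>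
  also have "\<dots> = two_adic_power \<xi> (P_exp \<tau> y)"
  proof (rule two_adic_power_eq[OF m, symmetric])
    show "2 ^ m dvd of_int e - P_exp \<tau> y"
      unfolding e_def using P_exp_dvd[of m \<tau> y] by (simp add: dvd_mult_right)
  qed
  finally show "\<sigma> \<xi> = two_adic_power \<xi> (P_exp (tree_action lab \<sigma>) y)" by (simp add: \<tau>_def)
qed

end
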